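(* Let $W(t)=t^{49}e^{-t}/\Gamma(50)$ for $t\ge0$, and let $m_k=\int_0^\infty t^kW(t)\,dt$ for $k=0,1,2,\dots$. There is no Borel probability measure $\nu$ on $[50,\infty)$ such that for every integer $k\ge1$, $$\int t^k\,d\nu(t)\ \ge\ m_k\qquad\text{and}\qquad50\int t^{k-1}\,d\nu(t)\ \le\ m_k.$$
   Context: $\Gamma$ denotes the Gamma function. *)

theory Defs
  imports "HOL-Probability.Probability"
begin

(* Only the values at t >= 0 are used: the moments m k integrate over {0..}. *)
definition W :: "real \<Rightarrow> real" where
  "W t = t ^ 49 * exp (- t) / Gamma 50"

definition m :: "nat \<Rightarrow> real" where
  "m k = (LINT t:{0..}|lborel. t ^ k * W t)"

end

theory Submission
  imports Defs
begin

text \<open>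
  Writing \<open>M\<^sub>k\<close> for the moments of \<open>\<nu>\<close>, the hypotheses give \<open>m k \<le> M\<^sub>k \<le> m (k + 1) / 50\<close> for
  \<open>k \<ge> 1\<close>. Three of these bounds already clash: the polynomial \<open>3 v^16 - 8 v^8 + 16 v - 11\<close>
  has a double zero at \<open>v = 1\<close> and is nonnegative for \<open>v \<ge> 50/69\<close>, so integrating it at
  \<open>v = t/69\<close> against \<open>\<nu>\<close> bounds \<open>M\<^sub>8\<close> above in terms of \<open>M\<^sub>1\<close> and \<open>M\<^sub>1\<^sub>6\<close>, which contradicts
  \<open>M\<^sub>8 \<ge> m 8\<close>, \<open>M\<^sub>1 \<le> m 2 / 50\<close> and \<open>M\<^sub>1\<^sub>6 \<le> m 17 / 50\<close>. The exponents and the tangency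
  point \<open>69\<close> were found by solving the dual linear program numerically and rounding.
\<close>

text \<open>\<open>W\<close> is the Gamma density of shape 50, so its moments are quotients of Euler
  integrals.\<close>

lemma m_eq: "m k = fact (k + 49) / fact 49"
proof -
  have "has_bochner_integral lborel (\<lambda>t::real. t ^ (k + 49) * exp (- t) * indicator {0..} t) (fact (k + 49))"
  proof (rule has_bochner_integral_nn_integral)
    have "(\<integral>\<^sup>+ t. ennreal (t ^ (k + 49) * exp (- t) * indicator {0..} t) \<partial>lborel)
        = (\<integral>\<^sup>+ t. ennreal (t ^ (k + 49) * exp (- t)) * indicator {0..} t \<partial>lborel)"
      by (intro nn_integral_cong) (auto simp: indicator_def)
    then show "(\<integral>\<^sup>+ t. ennreal (t ^ (k + 49) * exp (- t) * indicator {0..} t) \<partial>lborel)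
        = ennreal (fact (k + 49))"
      by (simp add: nn_intergal_power_times_exp_Ici)
  qed (auto simp: indicator_def)
  then have "(LINT t|lborel. t ^ (k + 49) * exp (- t) * indicator {0..} t) = (fact (k + 49) :: real)"
    by (rule has_bochner_integral_integral_eq)
  moreover have "Gamma 50 = (fact 49 :: real)"
    using Gamma_fact[of 49, where ?'a = real] by simp
  then have "m k = (LINT t|lborel. t ^ (k + 49) * exp (- t) * indicator {0..} t / fact 49)"
    unfolding m_def set_lebesgue_integral_def W_def
    by (intro Bochner_Integration.integral_cong) (auto simp: power_add mult_ac)
  ultimately show ?thesis
    by simp
qed

text \<open>Dividing the difference of the two sides by \<open>(v - 1)^2\<close> leaves a polynomial
  with coefficients -11, -6, -1, 4, 9, ...; only the lowest three are negative, and from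
  \<open>50/69\<close> on the others outweigh them.\<close>

lemma power_8_le_power_16:
  fixes v :: real
  assumes "v \<ge> 50/69"
  shows "8 * v ^ 8 + 11 \<le> 3 * v ^ 16 + 16 * v"
proof -
  \<comment> \<open>The cubic coefficient 4 of the quotient is split as \<open>13/5 + 7/5\<close>:
    the part \<open>7/5\<close> absorbs \<open>- v^2\<close>, since
    \<open>7/5 * 50/69 = 70/69\<close>, and \<open>v * S v\<close> has to absorb
    \<open>11 + 6 * v\<close>.\<close>
  define S :: "real \<Rightarrow> real" where
    "S = (\<lambda>x. 13/5 * x^2 + 9 * x^3 + 14 * x^4 + 19 * x^5 + 24 * x^6 + 21 * x^7
       + 18 * x^8 + 15 * x^9 + 12 * x^10 + 9 * x^11 + 6 * x^12 + 3 * x^13)"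
  have "11 * (69/50) + 6 \<le> S (50/69)"
    unfolding S_def by (simp add: power_divide)
  also have "S (50/69) \<le> S v"
    unfolding S_def using assms by (intro add_mono mult_left_mono power_mono) auto
  finally have le_S: "11 * (69/50) + 6 \<le> S v" .
  have "11 + 6 * v \<le> v * (11 * (69/50) + 6)"
    using assms by (simp add: field_simps)
  also have "\<dots> \<le> v * S v"
    using assms le_S by (intro mult_left_mono) auto
  finally have "0 \<le> v * S v - (11 + 6 * v)"
    by simp
  moreover have "0 \<le> v\<^sup>2 * (7/5 * v - 1)"
    using assms by (intro mult_nonneg_nonneg) auto
  ultimately have "0 \<le> (v - 1)\<^sup>2 * (v * S v - (11 + 6 * v) + v\<^sup>2 * (7/5 * v - 1))"
    by (rule mult_nonneg_nonneg[OF zero_le_power2 add_nonneg_nonneg])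
  also have "\<dots> = 3 * v ^ 16 + 16 * v - (8 * v ^ 8 + 11)"
    unfolding S_def by algebra
  finally show ?thesis
    by simp
qed

theorem proposition7p3:
  "\<not> (\<exists>\<nu> :: real measure.
        prob_space \<nu> \<and> sets \<nu> = sets (restrict_space borel {50..}) \<and>
        (\<forall>k::nat. k \<ge> 1 \<longrightarrow>
           (\<integral>\<^sup>+ t. ennreal (t ^ k) \<partial>\<nu>) \<ge> ennreal (m k) \<and>
           50 * (\<integral>\<^sup>+ t. ennreal (t ^ (k - 1)) \<partial>\<nu>) \<le> ennreal (m k)))"
proof
  assume "\<exists>\<nu> :: real measure.
        prob_space \<nu> \<and> sets \<nu> = sets (restrict_space borel {50..}) \<and>
        (\<forall>k::nat. k \<ge> 1 \<longrightarrow>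
           (\<integral>\<^sup>+ t. ennreal (t ^ k) \<partial>\<nu>) \<ge> ennreal (m k) \<and>
           50 * (\<integral>\<^sup>+ t. ennreal (t ^ (k - 1)) \<partial>\<nu>) \<le> ennreal (m k))"
  then obtain \<nu> :: "real measure" where
    "prob_space \<nu>" and sets: "sets \<nu> = sets (restrict_space borel {50..})"
    and lower: "\<And>k. k \<ge> 1 \<Longrightarrow> ennreal (m k) \<le> (\<integral>\<^sup>+ t. ennreal (t ^ k) \<partial>\<nu>)"
    and upper: "\<And>k. k \<ge> 1 \<Longrightarrow> 50 * (\<integral>\<^sup>+ t. ennreal (t ^ (k - 1)) \<partial>\<nu>) \<le> ennreal (m k)"
    by blast
  interpret prob_space \<nu> by fact
  have space: "space \<nu> = {50..}"
    using sets_eq_imp_space_eq[OF sets] by (simp add: space_restrict_space)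
  have meas [measurable]: "(\<lambda>t. t ^ k) \<in> borel_measurable \<nu>" for k
    by (subst measurable_cong_sets[OF sets refl]) (intro measurable_restrict_space1, measurable)
  define M where "M k = expectation (\<lambda>t. t ^ k)" for k
  \<comment> \<open>Taken at \<open>Suc k\<close>, the second hypothesis bounds every moment by a
    finite number, which also yields integrability below.\<close>
  have nn_le: "(\<integral>\<^sup>+ t. ennreal (t ^ k) \<partial>\<nu>) \<le> ennreal (m (Suc k) / 50)" for k
  proof -
    have "ennreal (1/50) * (50 * (\<integral>\<^sup>+ t. ennreal (t ^ k) \<partial>\<nu>)) \<le> ennreal (1/50) * ennreal (m (Suc k))"
      using upper[of "Suc k"] by (intro mult_left_mono) auto
    also have "\<dots> = ennreal (m (Suc k) / 50)"
      by (simp add: ennreal_mult'[symmetric])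
    also have "ennreal (1/50) * (50 * (\<integral>\<^sup>+ t. ennreal (t ^ k) \<partial>\<nu>)) = (\<integral>\<^sup>+ t. ennreal (t ^ k) \<partial>\<nu>)"
      by (simp add: mult.assoc[symmetric] ennreal_mult[symmetric] flip: ennreal_numeral)
    finally show ?thesis .
  qed
  have int: "integrable \<nu> (\<lambda>t. t ^ k)" for k
    using nn_le[of k] space
    by (intro integrableI_nonneg AE_I2) (auto simp: le_less_trans)
  have nn_eq: "(\<integral>\<^sup>+ t. ennreal (t ^ k) \<partial>\<nu>) = ennreal (M k)" for k
    unfolding M_def using int space by (intro nn_integral_eq_integral AE_I2) auto
  have M_upper: "M k \<le> m (Suc k) / 50" for k
    using nn_le[of k] unfolding nn_eq by (simp add: m_eq)
  have M_lower: "m k \<le> M k" if "k \<ge> 1" for k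
    using lower[OF that] space unfolding nn_eq
    by (subst (asm) ennreal_le_iff) (auto simp: M_def intro!: integral_nonneg_AE AE_I2)
  have "8 * M 8 / 69^8 + 11 = expectation (\<lambda>t. 8 * t^8 / 69^8 + 11)"
    using int by (simp add: M_def prob_space)
  also have "\<dots> \<le> expectation (\<lambda>t. 3 * t^16 / 69^16 + 16 * t^1 / 69)"
  proof (rule integral_mono)
    fix t assume "t \<in> space \<nu>"
    then show "8 * t^8 / 69^8 + 11 \<le> 3 * t^16 / 69^16 + 16 * t^1 / 69"
      using power_8_le_power_16[of "t / 69"] space by (simp add: power_divide)
  qed (use int int[of 1] in auto)
  also have "\<dots> = 3 * M 16 / 69^16 + 16 * M 1 / 69"
    using int int[of 1] by (simp add: M_def)
  finally have "8 * m 8 / 69^8 + 11 \<le> 3 * (m 17 / 50) / 69^16 + 16 * (m 2 / 50) / 69"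
    using M_lower[of 8] M_upper[of 16] M_upper[of 1] by (simp add: numeral_2_eq_2)
  \<comment> \<open>This recurrence evaluates \<open>m 2\<close>, \<open>m 8\<close> and
    \<open>m 17\<close>, turning the last inequality into a false numerical one.\<close>
  moreover have "m 0 = 1" "m (Suc k) = real (k + 50) * m k" for k
    unfolding m_eq add_Suc fact_Suc by simp_all
  ultimately show False
    by (simp add: eval_nat_numeral)
qed

end
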